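(* Any conic simplicial group $G_*$ is contractible.
   Context: A simplicial group $G_*=\{G_n\}_{n\ge 0}$ is a sequence of groups with face homomorphisms $d_i\colon G_n\to G_{n-1}$ and degeneracy homomorphisms $s_i\colon G_n\to G_{n+1}$, $0\le i\le n$, satisfying the simplicial identities: $d_id_j=d_{j-1}d_i$ for $i<j$; $s_is_j=s_{j+1}s_i$ for $i\le j$; $d_is_j=s_{j-1}d_i$ for $i<j$; $d_js_j=\mathrm{id}=d_{j+1}s_j$; $d_is_j=s_jd_{i-1}$ for $i>j+1$. A simplicial group $G_*$ is called conic if there exists (in each dimension) an extra degeneracy homomorphism $s_n\colon G_{n-1}\to G_n$ so that the simplicial identities, including the formulae involving $s_n$, hold; in particular $d_js_n=s_{n-1}d_j$ for $j<n$ and $d_ns_n=\mathrm{id}$. The Moore cycles are $\mathrm{Z}_n(G_* )=\bigcap_{i=0}^n\mathrm{Ker}(d_i\colon G_n\to G_{n-1})$, the Moore boundaries are $\mathcal{B}_n(G_* )=d_0\left(\bigcap_{i=1}^{n+1}\mathrm{Ker}(d_i\colon G_{n+1}\to G_n)\right)$, which form a normal subgroup of $\mathrm{Z}_n(G_* )$, and $\pi_n(G_* )=\mathrm{Z}_n(G_* )/\mathcal{B}_n(G_* )$ is the Moore homotopy group, isomorphic to the $n$-th homotopy group of the geometric realization of $G_*$. Contractibility of $G_*$ means that $\pi_n(G_* )=0$ for all $n$. *)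

theory Defs
  imports "HOL-Algebra.Elementary_Groups"
begin

(* G n is the n-th group; both operators carry the dimension of their source:
   d n i : G_n -> G_(n-1) (for n >= 1) and s n i : G_n -> G_(n+1), with i <= n.
   Values of d and s outside these ranges are irrelevant. *)
locale simplicial_group =
  fixes G :: "nat \<Rightarrow> ('a, 'b) monoid_scheme"
    and d :: "nat \<Rightarrow> nat \<Rightarrow> 'a \<Rightarrow> 'a"
    and s :: "nat \<Rightarrow> nat \<Rightarrow> 'a \<Rightarrow> 'a"
  assumes group_G: "group (G n)"
    and face_hom: "i \<le> Suc n \<Longrightarrow> d (Suc n) i \<in> hom (G (Suc n)) (G n)"
    and degen_hom: "i \<le> n \<Longrightarrow> s n i \<in> hom (G n) (G (Suc n))"
    and face_face:
      "\<lbrakk>i < j; j \<le> Suc (Suc n); x \<in> carrier (G (Suc (Suc n)))\<rbrakk> \<Longrightarrow>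
         d (Suc n) i (d (Suc (Suc n)) j x) = d (Suc n) (j - 1) (d (Suc (Suc n)) i x)"
    and degen_degen:
      "\<lbrakk>i \<le> j; j \<le> n; x \<in> carrier (G n)\<rbrakk> \<Longrightarrow>
         s (Suc n) i (s n j x) = s (Suc n) (Suc j) (s n i x)"
    and face_degen_less:
      "\<lbrakk>i < j; j \<le> Suc n; x \<in> carrier (G (Suc n))\<rbrakk> \<Longrightarrow>
         d (Suc (Suc n)) i (s (Suc n) j x) = s n (j - 1) (d (Suc n) i x)"
    and face_degen_same:
      "\<lbrakk>j \<le> n; x \<in> carrier (G n)\<rbrakk> \<Longrightarrow> d (Suc n) j (s n j x) = x"
    and face_degen_Suc:
      "\<lbrakk>j \<le> n; x \<in> carrier (G n)\<rbrakk> \<Longrightarrow> d (Suc n) (Suc j) (s n j x) = x"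
    and face_degen_greater:
      "\<lbrakk>Suc j < i; i \<le> Suc (Suc n); x \<in> carrier (G (Suc n))\<rbrakk> \<Longrightarrow>
         d (Suc (Suc n)) i (s (Suc n) j x) = s n j (d (Suc n) (i - 1) x)"

(* e n : G_n -> G_(n+1) is the extra degeneracy s_(n+1), and the identities are
   the simplicial ones in which it occurs.  Here, as in the Moore cycles below,
   G_(-1) is the trivial group: the identity d_0 s_1 = s_0 d_0 on G_0, whose
   right-hand side factors through G_(-1), is extra_face_zero.  Without it every
   constant simplicial group would be conic. *)
locale extra_degeneracy = simplicial_group G d s
  for G :: "nat \<Rightarrow> ('a, 'b) monoid_scheme"
    and d :: "nat \<Rightarrow> nat \<Rightarrow> 'a \<Rightarrow> 'a"
    and s :: "nat \<Rightarrow> nat \<Rightarrow> 'a \<Rightarrow> 'a" +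
  fixes e :: "nat \<Rightarrow> 'a \<Rightarrow> 'a"
  assumes extra_hom: "e n \<in> hom (G n) (G (Suc n))"
    and extra_face_last: "x \<in> carrier (G n) \<Longrightarrow> d (Suc n) (Suc n) (e n x) = x"
    and extra_face_less:
      "\<lbrakk>j \<le> Suc n; x \<in> carrier (G (Suc n))\<rbrakk> \<Longrightarrow>
         d (Suc (Suc n)) j (e (Suc n) x) = e n (d (Suc n) j x)"
    and extra_face_zero: "x \<in> carrier (G 0) \<Longrightarrow> d (Suc 0) 0 (e 0 x) = \<one>\<^bsub>G 0\<^esub>"
    and extra_degen:
      "\<lbrakk>i \<le> n; x \<in> carrier (G n)\<rbrakk> \<Longrightarrow> s (Suc n) i (e n x) = e (Suc n) (s n i x)"
    and extra_degen_last:
      "x \<in> carrier (G n) \<Longrightarrow> s (Suc n) (Suc n) (e n x) = e (Suc n) (e n x)"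

definition conic ::
  "(nat \<Rightarrow> ('a, 'b) monoid_scheme) \<Rightarrow> (nat \<Rightarrow> nat \<Rightarrow> 'a \<Rightarrow> 'a) \<Rightarrow> (nat \<Rightarrow> nat \<Rightarrow> 'a \<Rightarrow> 'a) \<Rightarrow> bool"
  where "conic G d s \<longleftrightarrow> (\<exists>e. extra_degeneracy G d s e)"

(* Z_0 = G_0, since the target G_(-1) of d_0 is trivial. *)
definition moore_cycles ::
  "(nat \<Rightarrow> ('a, 'b) monoid_scheme) \<Rightarrow> (nat \<Rightarrow> nat \<Rightarrow> 'a \<Rightarrow> 'a) \<Rightarrow> nat \<Rightarrow> 'a set"
  where "moore_cycles G d n =
    {x \<in> carrier (G n). n > 0 \<longrightarrow> (\<forall>i\<le>n. x \<in> kernel (G n) (G (n - 1)) (d n i))}"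

definition moore_boundaries ::
  "(nat \<Rightarrow> ('a, 'b) monoid_scheme) \<Rightarrow> (nat \<Rightarrow> nat \<Rightarrow> 'a \<Rightarrow> 'a) \<Rightarrow> nat \<Rightarrow> 'a set"
  where "moore_boundaries G d n =
    d (Suc n) 0 ` (\<Inter>i\<in>{1..Suc n}. kernel (G (Suc n)) (G n) (d (Suc n) i))"

definition moore_homotopy ::
  "(nat \<Rightarrow> ('a, 'b) monoid_scheme) \<Rightarrow> (nat \<Rightarrow> nat \<Rightarrow> 'a \<Rightarrow> 'a) \<Rightarrow> nat \<Rightarrow> 'a set monoid"
  where "moore_homotopy G d n =
    (G n)\<lparr>carrier := moore_cycles G d n\<rparr> Mod moore_boundaries G d n"

definition contractible ::
  "(nat \<Rightarrow> ('a, 'b) monoid_scheme) \<Rightarrow> (nat \<Rightarrow> nat \<Rightarrow> 'a \<Rightarrow> 'a) \<Rightarrow> bool"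
  where "contractible G d \<longleftrightarrow> (\<forall>n. trivial_group (moore_homotopy G d n))"

end

theory Submission
  imports Defs
begin

text \<open>
  The extra degeneracy sends a Moore cycle \<open>x \<in> G\<^sub>n\<close> to an element of \<open>G\<^sub>n\<^sub>+\<^sub>1\<close> whose faces are all
  trivial except the last, which is \<open>x\<close>.  Moore boundaries ask instead that the face number
  \<open>0\<close> be the only nontrivial one.  The two conditions are reconciled by moving the nontrivial face
  down one index at a time: if \<open>y\<close> has \<open>x\<close> as its face \<open>k + 1\<close> and trivial faces otherwise, then
  \<open>y\<^sup>-\<^sup>1 \<cdot> s\<^sub>k x\<close> has \<open>x\<close> as its face \<open>k\<close> and trivial faces otherwise, because for a cycle \<open>x\<close> the
  degenerate element \<open>s\<^sub>k x\<close> has the faces \<open>k\<close> and \<open>k + 1\<close> equal to \<open>x\<close> and all others trivial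
  (lemma \<open>bounds_via_face_lower\<close>).  Hence every cycle is a boundary.  Conversely
  boundaries are always cycles, so each homotopy group is the quotient of a group by itself.
\<close>

lemma (in group) trivial_group_Mod_carrier: "trivial_group (G Mod carrier G)"
proof -
  have "carrier G \<lhd> G"
    by (rule normal_invI[OF subgroup_self]) auto
  then have "group (G Mod carrier G)"
    by (rule normal.factorgroup_is_group)
  moreover have "rcosets (carrier G) = {carrier G}"
    using coset_join2[OF _ subgroup_self] by (auto simp: RCOSETS_def)
  ultimately show ?thesis
    by (simp add: trivial_group_def FactGroup_def)
qed

text \<open>
  The index \<open>k\<close> interpolates between Moore boundaries, where \<open>k = 0\<close>, and what the extra degeneracy
  provides, where \<open>k = n + 1\<close>.
\<close>

definition bounds_via_face ::
  "(nat \<Rightarrow> ('a, 'b) monoid_scheme) \<Rightarrow> (nat \<Rightarrow> nat \<Rightarrow> 'a \<Rightarrow> 'a) \<Rightarrow> nat \<Rightarrow> nat \<Rightarrow> 'a \<Rightarrow> 'a \<Rightarrow> bool"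
  where "bounds_via_face G d n k x y \<longleftrightarrow> y \<in> carrier (G (Suc n)) \<and>
    (\<forall>i\<le>Suc n. d (Suc n) i y = (if i = k then x else \<one>\<^bsub>G n\<^esub>))"

context simplicial_group
begin

lemma face_group_hom: "i \<le> Suc n \<Longrightarrow> group_hom (G (Suc n)) (G n) (d (Suc n) i)"
  by (simp add: group_hom_def group_hom_axioms_def group_G face_hom)

lemma degen_group_hom: "i \<le> n \<Longrightarrow> group_hom (G n) (G (Suc n)) (s n i)"
  by (simp add: group_hom_def group_hom_axioms_def group_G degen_hom)

lemma moore_cycles_0: "moore_cycles G d 0 = carrier (G 0)"
  by (simp add: moore_cycles_def)

lemma moore_cycles_Suc:
  "moore_cycles G d (Suc n) =
     {x \<in> carrier (G (Suc n)). \<forall>i\<le>Suc n. d (Suc n) i x = \<one>\<^bsub>G n\<^esub>}"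
  by (auto simp: moore_cycles_def kernel_def)

lemma moore_cycles_carrier: "x \<in> moore_cycles G d n \<Longrightarrow> x \<in> carrier (G n)"
  by (simp add: moore_cycles_def)

lemma subgroup_moore_cycles: "subgroup (moore_cycles G d n) (G n)"
proof (cases n)
  case 0
  then show ?thesis
    by (simp add: moore_cycles_0 group.subgroup_self group_G)
next
  case (Suc m)
  have "moore_cycles G d n = (\<Inter>i\<in>{..n}. kernel (G n) (G m) (d n i))"
    by (auto simp: Suc moore_cycles_Suc kernel_def)
  moreover have "subgroup (\<Inter>i\<in>{..n}. kernel (G n) (G m) (d n i)) (G n)"
    by (rule group.subgroups_Inter[OF group_G])
      (auto simp: Suc intro: group_hom.subgroup_kernel[OF face_group_hom])
  ultimately show ?thesis by simp
qed

lemma mem_moore_boundaries_iff: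
  "x \<in> moore_boundaries G d n \<longleftrightarrow> (\<exists>y. bounds_via_face G d n 0 x y)"
proof
  assume "x \<in> moore_boundaries G d n"
  then obtain y where y: "x = d (Suc n) 0 y"
    and ker: "\<And>i. 1 \<le> i \<Longrightarrow> i \<le> Suc n \<Longrightarrow> y \<in> kernel (G (Suc n)) (G n) (d (Suc n) i)"
    by (auto simp: moore_boundaries_def)
  have "bounds_via_face G d n 0 x y"
    using y ker ker[of 1] by (auto simp: bounds_via_face_def kernel_def)
  then show "\<exists>y. bounds_via_face G d n 0 x y" ..
next
  assume "\<exists>y. bounds_via_face G d n 0 x y"
  then show "x \<in> moore_boundaries G d n"
    by (force simp: bounds_via_face_def moore_boundaries_def kernel_def)
qed

text \<open>
  The identity \<open>d\<^sub>i d\<^sub>0 = d\<^sub>0 d\<^sub>i\<^sub>+\<^sub>1\<close> turns every face of \<open>d\<^sub>0 y\<close> into the image of a face of \<open>y\<close> of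
  positive index, and these are trivial.
\<close>

lemma moore_boundaries_subset_cycles: "moore_boundaries G d n \<subseteq> moore_cycles G d n"
proof
  fix x assume "x \<in> moore_boundaries G d n"
  then obtain y where y: "y \<in> carrier (G (Suc n))" "d (Suc n) 0 y = x"
    and triv: "\<And>i. 0 < i \<Longrightarrow> i \<le> Suc n \<Longrightarrow> d (Suc n) i y = \<one>\<^bsub>G n\<^esub>"
    by (auto simp: mem_moore_boundaries_iff bounds_via_face_def)
  have x: "x \<in> carrier (G n)"
    using group_hom.hom_closed[OF face_group_hom] y by fastforce
  show "x \<in> moore_cycles G d n"
  proof (cases n)
    case 0
    then show ?thesis using x by (simp add: moore_cycles_0)
  next
    case (Suc m)
    have "d (Suc m) i x = \<one>\<^bsub>G m\<^esub>" if "i \<le> Suc m" for i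
    proof -
      have "d (Suc m) i x = d (Suc m) 0 (d (Suc (Suc m)) (Suc i) y)"
        using face_face[of 0 "Suc i" m y] y that by (simp add: Suc)
      also have "\<dots> = \<one>\<^bsub>G m\<^esub>"
        using triv[of "Suc i"] that group_hom.hom_one[OF face_group_hom[of 0 m]]
        by (simp add: Suc)
      finally show ?thesis .
    qed
    then show ?thesis using x by (simp add: Suc moore_cycles_Suc)
  qed
qed

text \<open>
  Away from the indices \<open>k\<close> and \<open>k + 1\<close>, a face operator moves past \<open>s\<^sub>k\<close> and becomes a face of the
  cycle \<open>x\<close>, hence trivial.  In dimension \<open>0\<close> these two indices are the only ones.
\<close>

lemma face_degen_cycle:
  assumes x: "x \<in> moore_cycles G d n" and k: "k \<le> n" and i: "i \<le> Suc n"
  shows "d (Suc n) i (s n k x) = (if i = k \<or> i = Suc k then x else \<one>\<^bsub>G n\<^esub>)"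
proof (cases n)
  case 0
  then show ?thesis
    using face_degen_same[OF k] face_degen_Suc[OF k] x k i
    by (auto simp: moore_cycles_carrier le_Suc_eq)
next
  case (Suc m)
  have xc: "x \<in> carrier (G (Suc m))"
    and triv: "\<And>j. j \<le> Suc m \<Longrightarrow> d (Suc m) j x = \<one>\<^bsub>G m\<^esub>"
    using x by (auto simp: Suc moore_cycles_Suc)
  have degen_one: "\<And>j. j \<le> m \<Longrightarrow> s m j \<one>\<^bsub>G m\<^esub> = \<one>\<^bsub>G (Suc m)\<^esub>"
    using group_hom.hom_one[OF degen_group_hom] .
  consider "i < k" | "i = k" | "i = Suc k" | "Suc k < i"
    by linarith
  then show ?thesis
  proof cases
    case 1
    then show ?thesis
      using face_degen_less[of i k m x] xc triv[of i] degen_one[of "k - 1"] k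
      by (simp add: Suc)
  next
    case 2
    then show ?thesis using face_degen_same[OF k] xc by (simp add: Suc)
  next
    case 3
    then show ?thesis using face_degen_Suc[OF k] xc by (simp add: Suc)
  next
    case 4
    then show ?thesis
      using face_degen_greater[of k i m x] xc triv[of "i - 1"] degen_one[of k] i
      by (simp add: Suc)
  qed
qed

text \<open>
  The factor \<open>s\<^sub>k x\<close> contributes \<open>x\<close> at the faces \<open>k\<close> and \<open>k + 1\<close>; the factor \<open>y\<^sup>-\<^sup>1\<close> cancels the
  contribution at \<open>k + 1\<close> and is trivial at every other face.
\<close>

lemma bounds_via_face_lower:
  assumes x: "x \<in> moore_cycles G d n" and k: "k \<le> n"
    and y: "bounds_via_face G d n (Suc k) x y"
  shows "bounds_via_face G d n k x (inv\<^bsub>G (Suc n)\<^esub> y \<otimes>\<^bsub>G (Suc n)\<^esub> s n k x)"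
proof -
  interpret Gn: group "G n" by (rule group_G)
  interpret GS: group "G (Suc n)" by (rule group_G)
  have yc: "y \<in> carrier (G (Suc n))" using y by (simp add: bounds_via_face_def)
  have xc: "x \<in> carrier (G n)" using x by (rule moore_cycles_carrier)
  have sc: "s n k x \<in> carrier (G (Suc n))"
    using group_hom.hom_closed[OF degen_group_hom[OF k] xc] .
  have "d (Suc n) i (inv\<^bsub>G (Suc n)\<^esub> y \<otimes>\<^bsub>G (Suc n)\<^esub> s n k x) = (if i = k then x else \<one>\<^bsub>G n\<^esub>)"
    if i: "i \<le> Suc n" for i
  proof -
    interpret di: group_hom "G (Suc n)" "G n" "d (Suc n) i"
      using i by (rule face_group_hom)
    have "d (Suc n) i y = (if i = Suc k then x else \<one>\<^bsub>G n\<^esub>)"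
      using y i by (simp add: bounds_via_face_def)
    then show ?thesis
      using face_degen_cycle[OF x k i] yc sc xc by auto
  qed
  then show ?thesis using yc sc by (simp add: bounds_via_face_def)
qed

lemma bounds_via_face_imp_boundary:
  assumes x: "x \<in> moore_cycles G d n" and "k \<le> Suc n"
    and "bounds_via_face G d n k x y"
  shows "x \<in> moore_boundaries G d n"
  using assms(2,3)
proof (induction k arbitrary: y)
  case 0
  then show ?case by (auto simp: mem_moore_boundaries_iff)
next
  case (Suc k)
  then show ?case using bounds_via_face_lower[OF x, of k y] by auto
qed

end

text \<open>
  In positive dimension the face \<open>j \<le> n\<close> of the extra degeneracy of \<open>x\<close> is the extra degeneracy of
  \<open>d\<^sub>j x = 1\<close>.  In dimension \<open>0\<close> every element is a cycle, and the triviality of the face \<open>0\<close> is the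
  augmented identity \<open>d\<^sub>0 s\<^sub>1 = s\<^sub>0 d\<^sub>0\<close> through the trivial group \<open>G\<^sub>-\<^sub>1\<close>.
\<close>

lemma (in extra_degeneracy) extra_bounds_via_last_face:
  assumes x: "x \<in> moore_cycles G d n"
  shows "bounds_via_face G d n (Suc n) x (e n x)"
proof -
  have xc: "x \<in> carrier (G n)" using x by (rule moore_cycles_carrier)
  have "d (Suc n) i (e n x) = \<one>\<^bsub>G n\<^esub>" if i: "i \<le> n" for i
  proof (cases n)
    case 0
    then show ?thesis using extra_face_zero xc i by simp
  next
    case (Suc m)
    interpret em: group_hom "G m" "G (Suc m)" "e m"
      by (simp add: group_hom_def group_hom_axioms_def group_G extra_hom)
    show ?thesis
      using extra_face_less[of i m x] x i em.hom_one by (simp add: Suc moore_cycles_Suc)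
  qed
  moreover have "e n x \<in> carrier (G (Suc n))"
    using extra_hom xc by (rule hom_in_carrier)
  ultimately show ?thesis
    using extra_face_last[OF xc] by (simp add: bounds_via_face_def le_Suc_eq)
qed

theorem proposition3p1:
  fixes G :: "nat \<Rightarrow> ('a, 'b) monoid_scheme"
    and d s :: "nat \<Rightarrow> nat \<Rightarrow> 'a \<Rightarrow> 'a"
  assumes "simplicial_group G d s"
    and "conic G d s"
  shows "contractible G d"
proof -
  from assms(2) obtain e where "extra_degeneracy G d s e"
    by (auto simp: conic_def)
  then interpret extra_degeneracy G d s e .
  have "trivial_group (moore_homotopy G d n)" for n
  proof -
    have "moore_boundaries G d n = moore_cycles G d n"
      using moore_boundaries_subset_cycles
        bounds_via_face_imp_boundary[OF _ order_refl extra_bounds_via_last_face]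
      by blast
    moreover have "group ((G n)\<lparr>carrier := moore_cycles G d n\<rparr>)"
      by (rule subgroup.subgroup_is_group[OF subgroup_moore_cycles group_G])
    ultimately show ?thesis
      using group.trivial_group_Mod_carrier by (fastforce simp: moore_homotopy_def)
  qed
  then show ?thesis by (simp add: contractible_def)
qed

end
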